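(* (Cut elimination.) For any set of formulas $\Sigma$ and any finite multisets of formulas $\Gamma$, $\Delta$: if $\mathsf{S}+\mathsf{cut}\vdash \Sigma;\Gamma\Rightarrow\Delta$, then there is a slim cut-free $\infty$-proof of the sequent $\Sigma;\Gamma\Rightarrow\Delta$.
   Context: Formulas are built from propositional variables $p_0,p_1,\dots$ and $\bot$ by $\to$, $\Box$, $\Box^+$ (with $\neg A:=A\to\bot$, $\top:=\neg\bot$, $A\wedge B:=\neg(A\to\neg B)$, $A\vee B:=\neg A\to B$). A sequent is an expression $\Sigma;\Gamma\Rightarrow\Delta$ where $\Gamma,\Delta$ are finite multisets of formulas and $\Sigma$ is an arbitrary set of formulas. For a multiset $\Gamma=A_1,\dots,A_n$, $\Box\Gamma:=\Box A_1,\dots,\Box A_n$ and $\Box^+\Gamma:=\Box^+A_1,\dots,\Box^+A_n$. The calculus $\mathsf{S}$ has initial sequents $\Sigma;\Gamma,p\Rightarrow p,\Delta$ ($p$ a variable) and $\Sigma;\Gamma,\bot\Rightarrow\Delta$, and rules: ($\to_L$) from $\Sigma;\Gamma,B\Rightarrow\Delta$ and $\Sigma;\Gamma\Rightarrow A,\Delta$ infer $\Sigma;\Gamma,A\to B\Rightarrow\Delta$; ($\to_R$) from $\Sigma;\Gamma,A\Rightarrow B,\Delta$ infer $\Sigma;\Gamma\Rightarrow A\to B,\Delta$; ($\Box$) from $\Sigma;\Sigma_0,\Lambda,\Pi,\Box^+\Pi\Rightarrow A$ infer $\Sigma;\Phi,\Box\Lambda,\Box^+\Pi\Rightarrow\Box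 A,\Psi$; ($\Box^+$) from $\Sigma;\Sigma_0,\Lambda,\Pi,\Box^+\Pi\Rightarrow A$ (left premise) and $\Sigma;\Sigma_0,\Lambda,\Pi,\Box^+\Pi\Rightarrow\Box^+A$ (right premise) infer $\Sigma;\Phi,\Box\Lambda,\Box^+\Pi\Rightarrow\Box^+A,\Psi$; here $\Sigma_0$ is a finite subset of $\Sigma$ and $\Phi,\Psi,\Lambda,\Pi$ are finite multisets. In the modal rules $\Box^+A$ (resp. $\Box A$) is the principal formula. An application of a modal rule is slim if $\Lambda$ and $\Pi$ contain no repetitions. The rule ($\mathsf{cut}$) is: from $\Sigma;\Gamma\Rightarrow A,\Delta$ and $\Sigma;\Gamma,A\Rightarrow\Delta$ infer $\Sigma;\Gamma\Rightarrow\Delta$; $\mathsf{S}+\mathsf{cut}$ is $\mathsf{S}$ plus this rule. An $\infty$-proof is a possibly infinite tree of sequents built according to the rules of $\mathsf{S}+\mathsf{cut}$, in which every leaf is an initial sequent and every infinite branch has a tail such that: (a) all applications of ($\Box^+$) in the tail have the same principal formula; (b) the tail passes through the right premise of ($\Box^+$) infinitely many times; (c) the tail never passes through the left premise of ($\Box^+$); (d) the tail contains no applications of ($\Box$). An $\infty$-proof is cut-free if it contains no applications of ($\mathsf{cut}$), and slim if every application of a modal rule in it is slim. $\mathsf{S}+\mathsf{cut}\vdash\Sigma;\Gamma\Rightarrow\Delta$ means there is an $\infty$-proof with root $\Sigma;\Gamma\Rightarrow\Delta$. *)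

theory Defs
  imports "HOL-Library.Multiset"
begin

datatype fm =
    Var nat
  | Bot
  | Imp fm fm
  | Box fm
  | BoxP fm  \<comment> \<open>\<open>\<box>\<^sup>+\<close>\<close>

text \<open>A sequent \<open>\<Sigma>; \<Gamma> \<Rightarrow> \<Delta>\<close> is the triple \<open>(\<Sigma>, \<Gamma>, \<Delta>)\<close>; \<open>\<Sigma>\<close> may be infinite.\<close>

type_synonym sequent = "fm set \<times> fm multiset \<times> fm multiset"

text \<open>
  A rule application is not determined by its premises and conclusion alone: different
  choices of \<open>\<Lambda>\<close> and \<open>\<Pi>\<close> can give the same sequents. So every node of a tree carries a
  label naming the rule applied and, for the modal rules, the multisets \<open>\<Lambda>\<close> and \<open>\<Pi>\<close> (which
  decide slimness) and the formula \<open>A\<close> whose boxed form is principal.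
\<close>

datatype label =
    Init
  | ImpL
  | ImpR
  | BoxRule (lambda_part: "fm multiset") (pi_part: "fm multiset") (body: fm)
  | BoxPRule (lambda_part: "fm multiset") (pi_part: "fm multiset") (body: fm)
  | Cut

text \<open>
  \<open>inference r Ps C\<close>: the sequent \<open>C\<close> follows from the premises \<open>Ps\<close>, listed from left to
  right, by an application of a rule of \<open>S + cut\<close> labelled \<open>r\<close>.
\<close>

inductive inference :: "label \<Rightarrow> sequent list \<Rightarrow> sequent \<Rightarrow> bool" where
  init_Var: "inference Init [] (\<Sigma>, add_mset (Var p) \<Gamma>, add_mset (Var p) \<Delta>)"
| init_Bot: "inference Init [] (\<Sigma>, add_mset Bot \<Gamma>, \<Delta>)"
| ImpL: "inference ImpL
    [(\<Sigma>, add_mset B \<Gamma>, \<Delta>), (\<Sigma>, \<Gamma>, add_mset A \<Delta>)]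
    (\<Sigma>, add_mset (Imp A B) \<Gamma>, \<Delta>)"
| ImpR: "inference ImpR
    [(\<Sigma>, add_mset A \<Gamma>, add_mset B \<Delta>)]
    (\<Sigma>, \<Gamma>, add_mset (Imp A B) \<Delta>)"
| Box: "finite \<Sigma>\<^sub>0 \<Longrightarrow> \<Sigma>\<^sub>0 \<subseteq> \<Sigma> \<Longrightarrow> inference (BoxRule \<Lambda> \<Pi> A)
    [(\<Sigma>, mset_set \<Sigma>\<^sub>0 + \<Lambda> + \<Pi> + image_mset BoxP \<Pi>, {#A#})]
    (\<Sigma>, \<Phi> + image_mset Box \<Lambda> + image_mset BoxP \<Pi>, add_mset (Box A) \<Psi>)"
| BoxP: "finite \<Sigma>\<^sub>0 \<Longrightarrow> \<Sigma>\<^sub>0 \<subseteq> \<Sigma> \<Longrightarrow> inference (BoxPRule \<Lambda> \<Pi> A)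
    [(\<Sigma>, mset_set \<Sigma>\<^sub>0 + \<Lambda> + \<Pi> + image_mset BoxP \<Pi>, {#A#}),
     (\<Sigma>, mset_set \<Sigma>\<^sub>0 + \<Lambda> + \<Pi> + image_mset BoxP \<Pi>, {#BoxP A#})]
    (\<Sigma>, \<Phi> + image_mset Box \<Lambda> + image_mset BoxP \<Pi>, add_mset (BoxP A) \<Psi>)"
| Cut: "inference Cut
    [(\<Sigma>, \<Gamma>, add_mset A \<Delta>), (\<Sigma>, add_mset A \<Gamma>, \<Delta>)]
    (\<Sigma>, \<Gamma>, \<Delta>)"

codatatype tree = Node (concl: sequent) (label: label) (prems: "tree list")

inductive_set subtrees :: "tree \<Rightarrow> tree set" for t :: tree where
  self: "t \<in> subtrees t"
| prem: "s \<in> subtrees t \<Longrightarrow> u \<in> set (prems s) \<Longrightarrow> u \<in> subtrees t"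

text \<open>Leaves are initial sequents because only \<open>Init\<close> inferences have no premises.\<close>

definition built_by_rules :: "tree \<Rightarrow> bool" where
  "built_by_rules t \<longleftrightarrow>
     (\<forall>s \<in> subtrees t. inference (label s) (map concl (prems s)) (concl s))"

text \<open>
  A branch is given by its directions \<open>d\<close>: at depth \<open>n\<close> it goes to the premise with
  index \<open>d n\<close>.
\<close>

primrec node_at :: "tree \<Rightarrow> (nat \<Rightarrow> nat) \<Rightarrow> nat \<Rightarrow> tree" where
  "node_at t d 0 = t"
| "node_at t d (Suc n) = prems (node_at t d n) ! d n"

definition infinite_branch :: "tree \<Rightarrow> (nat \<Rightarrow> nat) \<Rightarrow> bool" where
  "infinite_branch t d \<longleftrightarrow> (\<forall>n. d n < length (prems (node_at t d n)))"

text \<open>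
  The tail considered starts at depth \<open>N\<close>. Premise 0 of \<open>BoxPRule\<close> is the left one,
  premise 1 the right one.
\<close>

definition good_branch :: "tree \<Rightarrow> (nat \<Rightarrow> nat) \<Rightarrow> bool" where
  "good_branch t d \<longleftrightarrow> (\<exists>N.
     (\<exists>F. \<forall>n\<ge>N. is_BoxPRule (label (node_at t d n)) \<longrightarrow>
        BoxP (body (label (node_at t d n))) = F) \<and>
     (\<exists>\<^sub>\<infinity>n. n \<ge> N \<and> is_BoxPRule (label (node_at t d n)) \<and> d n = 1) \<and>
     (\<forall>n\<ge>N. \<not> (is_BoxPRule (label (node_at t d n)) \<and> d n = 0)) \<and>
     (\<forall>n\<ge>N. \<not> is_BoxRule (label (node_at t d n))))"

definition inf_proof :: "tree \<Rightarrow> bool" where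
  "inf_proof t \<longleftrightarrow>
     built_by_rules t \<and> (\<forall>d. infinite_branch t d \<longrightarrow> good_branch t d)"

definition cut_free :: "tree \<Rightarrow> bool" where
  "cut_free t \<longleftrightarrow> (\<forall>s \<in> subtrees t. label s \<noteq> Cut)"

definition no_repetitions :: "'a multiset \<Rightarrow> bool" where
  "no_repetitions M \<longleftrightarrow> (\<forall>x. count M x \<le> 1)"

definition slim :: "tree \<Rightarrow> bool" where
  "slim t \<longleftrightarrow> (\<forall>s \<in> subtrees t. is_BoxRule (label s) \<or> is_BoxPRule (label s) \<longrightarrow>
     no_repetitions (lambda_part (label s)) \<and> no_repetitions (pi_part (label s)))"

definition provable_with_cut :: "sequent \<Rightarrow> bool" where
  "provable_with_cut C \<longleftrightarrow> (\<exists>t. inf_proof t \<and> concl t = C)"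

end

theory Submission
  imports Defs "HOL-Library.Infinite_Set"
begin

text \<open>
  The argument is semantic. Formulas are interpreted in the powerset of a neighbourhood frame,
  with \<open>\<box>\<^sup>+A\<close> the greatest \<open>Z\<close> such that \<open>Z = \<box>(A \<inter> Z)\<close>. Soundness with cut: if a node of a
  proof is refuted, then goodness of branches yields a refuted node above which only one
  formula \<open>\<box>\<^sup>+F\<close> is ever principal, by right premises; the points refuting nodes of that region
  form a post-fixed point, hence lie in \<open>\<box>\<^sup>+F\<close>, a contradiction. Completeness without cut: the
  canonical frame of saturated pairs refutes every sequent that has no slim cut-free proof.
\<close>

section \<open>Branches and subtrees\<close>

text \<open>No cut is ever rewritten: a proof with cuts only certifies that its root is irrefutable,
  and a new tree is built from that fact. Two obstacles shape the argument. Goodness concerns whole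
  branches, so soundness is not an induction on the tree; a refutation is followed upwards until it
  has settled on one principal formula. Conversely, an infinite tree for a sequent with
  \<open>BoxP B\<close> on the right must come out of the bare fact that the worlds extending it lie
  in a fixed point. That fact is itself the corecursive invariant: unfolding the fixed point once
  yields a derivable left premise of the rule, and a right premise that satisfies the invariant
  again. The canonical neighbourhoods are generated by finite contexts, as the rules demand even for
  infinite \<Sigma>; since \<Lambda> and \<Pi> range there over sets, slimness costs
  nothing.\<close>

lemma subtrees_trans:
  assumes "s \<in> subtrees u" "u \<in> subtrees t" shows "s \<in> subtrees t"
  using assms by (induction rule: subtrees.induct) (auto intro: subtrees.prem)

lemma subtrees_prem: "u \<in> set (prems t) \<Longrightarrow> s \<in> subtrees u \<Longrightarrow> s \<in> subtrees t"
  by (meson subtrees.self subtrees.prem subtrees_trans)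

lemma node_at_add: "node_at t d (m + n) = node_at (node_at t d m) (\<lambda>k. d (m + k)) n"
  by (induction n) auto

lemma infinite_branch_shift:
  "infinite_branch t d \<Longrightarrow> infinite_branch (node_at t d m) (\<lambda>k. d (m + k))"
  unfolding infinite_branch_def by (metis node_at_add)

text \<open>Goodness speaks of a tail only. This direction lets a branch that enters a finished
  proof inherit goodness from it.\<close>

lemma good_branch_unshift:
  assumes "good_branch (node_at t d m) (\<lambda>k. d (m + k))"
  shows "good_branch t d"
proof -
  let ?P = "\<lambda>n. label (node_at t d n)"
  obtain N F where
    F: "\<And>n. n \<ge> N \<Longrightarrow> is_BoxPRule (?P (m + n)) \<Longrightarrow> BoxP (body (?P (m + n))) = F" and
    I: "\<exists>\<^sub>\<infinity>n. n \<ge> N \<and> is_BoxPRule (?P (m + n)) \<and> d (m + n) = 1" and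
    L: "\<And>n. n \<ge> N \<Longrightarrow> \<not> (is_BoxPRule (?P (m + n)) \<and> d (m + n) = 0)" and
    B: "\<And>n. n \<ge> N \<Longrightarrow> \<not> is_BoxRule (?P (m + n))"
    using assms unfolding good_branch_def by (auto simp: node_at_add)
  have sh: "Q k" if "k \<ge> m + N" "\<And>n. n \<ge> N \<Longrightarrow> Q (m + n)" for Q k
    using that(2)[of "k - m"] that(1) by simp
  have "\<exists>n>k. n \<ge> m + N \<and> is_BoxPRule (?P n) \<and> d n = 1" for k
  proof -
    obtain n where "n > k" "n \<ge> N" "is_BoxPRule (?P (m + n))" "d (m + n) = 1"
      using I unfolding INFM_nat by blast
    then show ?thesis by (intro exI[of _ "m + n"]) auto
  qed
  then have I': "\<exists>\<^sub>\<infinity>n. n \<ge> m + N \<and> is_BoxPRule (?P n) \<and> d n = 1"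
    unfolding INFM_nat by blast
  show ?thesis
    unfolding good_branch_def
  proof (intro exI[of _ "m + N"] conjI exI[of _ F] I' allI impI)
    fix n assume n: "m + N \<le> n"
    show "is_BoxPRule (?P n) \<Longrightarrow> BoxP (body (?P n)) = F"
      using sh[OF n, of "\<lambda>n. is_BoxPRule (?P n) \<longrightarrow> BoxP (body (?P n)) = F"] F by blast
    show "\<not> (is_BoxPRule (?P n) \<and> d n = 0)"
      using sh[OF n, of "\<lambda>n. \<not> (is_BoxPRule (?P n) \<and> d n = 0)"] L by blast
    show "\<not> is_BoxRule (?P n)"
      using sh[OF n, of "\<lambda>n. \<not> is_BoxRule (?P n)"] B by blast
  qed
qed

lemma good_branch_shift:
  assumes "good_branch t d"
  shows "good_branch (node_at t d m) (\<lambda>k. d (m + k))"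
proof -
  let ?P = "\<lambda>n. label (node_at t d n)"
  obtain N F where
    F: "\<And>n. n \<ge> N \<Longrightarrow> is_BoxPRule (?P n) \<Longrightarrow> BoxP (body (?P n)) = F" and
    I: "\<exists>\<^sub>\<infinity>n. n \<ge> N \<and> is_BoxPRule (?P n) \<and> d n = 1" and
    L: "\<And>n. n \<ge> N \<Longrightarrow> \<not> (is_BoxPRule (?P n) \<and> d n = 0)" and
    B: "\<And>n. n \<ge> N \<Longrightarrow> \<not> is_BoxRule (?P n)"
    using assms unfolding good_branch_def by blast
  have "\<exists>n>k. n \<ge> N \<and> is_BoxPRule (?P (m + n)) \<and> d (m + n) = 1" for k
  proof -
    obtain n where "n > m + N + k" "is_BoxPRule (?P n)" "d n = 1"
      using I unfolding INFM_nat by blast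
    then show ?thesis by (intro exI[of _ "n - m"]) auto
  qed
  then have "\<exists>\<^sub>\<infinity>n. n \<ge> N \<and> is_BoxPRule (?P (m + n)) \<and> d (m + n) = 1"
    unfolding INFM_nat by blast
  then show ?thesis
    unfolding good_branch_def node_at_add[symmetric]
    using F L B by (intro exI[of _ N] conjI exI[of _ F]) auto
qed

lemma good_branch_prem:
  assumes "i < length (prems t)" "infinite_branch (prems t ! i) d"
    and "\<And>d. infinite_branch t d \<Longrightarrow> good_branch t d"
  shows "good_branch (prems t ! i) d"
proof -
  let ?e = "case_nat i d"
  have node: "node_at t ?e (Suc n) = node_at (prems t ! i) d n" for n
    using node_at_add[of t ?e 1 n] by simp
  have "infinite_branch t ?e"
    unfolding infinite_branch_def
  proof
    fix n show "?e n < length (prems (node_at t ?e n))"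
      using assms(1,2) node
      by (cases n) (auto simp: infinite_branch_def simp del: node_at.simps(2))
  qed
  from good_branch_shift[OF assms(3)[OF this], of 1] show ?thesis by simp
qed

lemma inf_proof_prem:
  assumes "inf_proof t" "u \<in> set (prems t)" shows "inf_proof u"
proof -
  obtain i where "i < length (prems t)" "u = prems t ! i"
    using assms(2) by (metis in_set_conv_nth)
  then show ?thesis
    using assms good_branch_prem subtrees_prem unfolding inf_proof_def built_by_rules_def by blast
qed

lemma inf_proof_inference:
  "inf_proof t \<Longrightarrow> inference (label t) (map concl (prems t)) (concl t)"
  by (simp add: inf_proof_def built_by_rules_def subtrees.self)

text \<open>Dependent choice along the tree. The state \<open>a\<close> travels with the node, so
  that \<open>R\<close> can relate its values before and after a step; in
  \<open>exists_no_escape\<close> it is the current candidate for the principal formula.\<close>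

lemma branch_by_choice:
  assumes "P t a"
    and step: "\<And>s a. P s a \<Longrightarrow>
      \<exists>i a'. i < length (prems s) \<and> P (prems s ! i) a' \<and> R s a i a'"
  obtains d f where "infinite_branch t d"
    "\<And>n. P (node_at t d n) (f n)" "\<And>n. R (node_at t d n) (f n) (d n) (f (Suc n))"
proof -
  obtain I G where IG: "\<And>s a. P s a \<Longrightarrow>
      I s a < length (prems s) \<and> P (prems s ! I s a) (G s a) \<and> R s a (I s a) (G s a)"
    using step by metis
  define \<sigma> where "\<sigma> = rec_nat (t, a) (\<lambda>_ (s, a). (prems s ! I s a, G s a))"
  define d where "d n = (case \<sigma> n of (s, a) \<Rightarrow> I s a)" for n
  have \<sigma>Suc: "\<sigma> (Suc n) = (case \<sigma> n of (s, a) \<Rightarrow> (prems s ! I s a, G s a))" for n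
    by (simp add: \<sigma>_def)
  have P: "P (fst (\<sigma> n)) (snd (\<sigma> n))" for n
  proof (induction n)
    case 0 then show ?case using assms(1) by (simp add: \<sigma>_def)
  next
    case (Suc n) then show ?case using IG by (simp add: \<sigma>Suc split: prod.split) force
  qed
  have node: "node_at t d n = fst (\<sigma> n)" for n
  proof (induction n)
    case 0 then show ?case by (simp add: \<sigma>_def)
  next
    case (Suc n) then show ?case by (simp add: \<sigma>Suc d_def split: prod.split)
  qed
  have d: "d n = I (fst (\<sigma> n)) (snd (\<sigma> n))" for n
    by (simp add: d_def split: prod.split)
  have snd: "snd (\<sigma> (Suc n)) = G (fst (\<sigma> n)) (snd (\<sigma> n))" for n
    by (simp add: \<sigma>Suc split: prod.split)
  show thesis
  proof (rule that[of d "\<lambda>n. snd (\<sigma> n)"])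
    show "infinite_branch t d" unfolding infinite_branch_def using IG P node d by auto
    show "P (node_at t d n) (snd (\<sigma> n))" for n using P node by simp
    show "R (node_at t d n) (snd (\<sigma> n)) (d n) (snd (\<sigma> (Suc n)))" for n
      using IG[OF P[of n]] node d snd by simp
  qed
qed

section \<open>Neighbourhood semantics and soundness\<close>

text \<open>The operator \<open>N\<close> need not preserve infinite intersections: in Kripke frames the
  calculus is incomplete for infinite \<open>\<Sigma>\<close>.\<close>

primrec sem :: "('w set \<Rightarrow> 'w set) \<Rightarrow> (nat \<Rightarrow> 'w set) \<Rightarrow> fm \<Rightarrow> 'w set" where
  "sem N v (Var p) = v p"
| "sem N v Bot = {}"
| "sem N v (Imp A B) = - sem N v A \<union> sem N v B"
| "sem N v (Box A) = N (sem N v A)"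
| "sem N v (BoxP A) = gfp (\<lambda>Z. N (sem N v A \<inter> Z))"

text \<open>The first three axioms say that the sets \<open>U\<close> with
  \<open>x \<in> N U\<close> form a filter, possibly improper. The last one asks for boxed
  assumptions because the rules insert members of \<Sigma> into premises of modal rules
  only.\<close>

locale frame =
  fixes N :: "'w set \<Rightarrow> 'w set" and v :: "nat \<Rightarrow> 'w set" and \<Sigma> :: "fm set"
  assumes N_mono: "U \<subseteq> V \<Longrightarrow> N U \<subseteq> N V"
    and N_Int: "N U \<inter> N V \<subseteq> N (U \<inter> V)"
    and N_UNIV: "N UNIV = UNIV"
    and N_assms: "A \<in> \<Sigma> \<Longrightarrow> N (sem N v A) = UNIV"
begin

abbreviation "sm \<equiv> sem N v"

lemma sm_BoxP_unfold: "sm (BoxP A) = N (sm A \<inter> sm (BoxP A))"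
proof -
  have "mono (\<lambda>Z. N (sm A \<inter> Z))" by (intro monoI N_mono) auto
  from gfp_unfold[OF this] show ?thesis by simp
qed

lemma sm_BoxP_coinduct: "W \<subseteq> N (sm A \<inter> W) \<Longrightarrow> W \<subseteq> sm (BoxP A)"
  by (simp add: gfp_upperbound)

definition holds :: "fm multiset \<Rightarrow> 'w set" where
  "holds \<Gamma> = {x. \<forall>A \<in># \<Gamma>. x \<in> sm A}"

lemma N_holds: "(\<And>A. A \<in># \<Gamma> \<Longrightarrow> x \<in> N (sm A)) \<Longrightarrow> x \<in> N (holds \<Gamma>)"
proof (induction \<Gamma>)
  case empty then show ?case by (simp add: holds_def N_UNIV)
next
  case (add A \<Gamma>)
  then have "x \<in> N (sm A \<inter> holds \<Gamma>)" using N_Int by auto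
  moreover have "sm A \<inter> holds \<Gamma> = holds (add_mset A \<Gamma>)" by (auto simp: holds_def)
  ultimately show ?case by simp
qed

text \<open>One unfolding turns the truth of \<open>BoxP B\<close> into membership in
  \<open>N (sm B \<inter> sm (BoxP B))\<close>; this is why the premise may list both
  \<open>B\<close> and \<open>BoxP B\<close> for every \<open>B\<close> in \<Pi>.\<close>

lemma holds_modal_context:
  assumes "finite \<Sigma>\<^sub>0" "\<Sigma>\<^sub>0 \<subseteq> \<Sigma>" "x \<in> holds (\<Phi> + image_mset Box \<Lambda> + image_mset BoxP \<Pi>)"
  shows "x \<in> N (holds (mset_set \<Sigma>\<^sub>0 + \<Lambda> + \<Pi> + image_mset BoxP \<Pi>))"
proof (rule N_holds)
  fix A assume A: "A \<in># mset_set \<Sigma>\<^sub>0 + \<Lambda> + \<Pi> + image_mset BoxP \<Pi>"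
  have \<Pi>: "x \<in> N (sm B) \<and> x \<in> N (sm (BoxP B))" if "B \<in># \<Pi>" for B
  proof -
    have "x \<in> sm (BoxP B)" using assms(3) that by (simp add: holds_def ball_Un)
    then have "x \<in> N (sm B \<inter> sm (BoxP B))" using sm_BoxP_unfold by blast
    then show ?thesis using N_mono[OF Int_lower1] N_mono[OF Int_lower2] by blast
  qed
  have "x \<in> N (sm B)" if "B \<in># \<Lambda>" for B
    using assms(3) that by (auto simp: holds_def dest!: bspec[of _ _ "Box B"])
  then show "x \<in> N (sm A)" using A \<Pi> assms(1,2) N_assms by auto
qed

section \<open>Passing refutations from a conclusion to its premises\<close>

definition refutes :: "'w \<Rightarrow> tree \<Rightarrow> bool" where
  "refutes x t \<longleftrightarrow> (case concl t of (\<Sigma>', \<Gamma>, \<Delta>) \<Rightarrow>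
     \<Sigma>' = \<Sigma> \<and> x \<in> holds \<Gamma> \<and> (\<forall>A \<in># \<Delta>. x \<notin> sm A))"

text \<open>A point either satisfies the cut formula or does not, so it refutes one of the two
  premises of a cut. For initial sequents the hypotheses are contradictory.\<close>

lemma refutes_local:
  assumes "inf_proof t" "refutes x t" "\<not> is_BoxRule (label t)" "\<not> is_BoxPRule (label t)"
  shows "\<exists>i < length (prems t). refutes x (prems t ! i)"
proof -
  have "\<exists>u \<in> set (prems t). refutes x u"
    using inf_proof_inference[OF assms(1)] assms(2-)
    by (cases rule: inference.cases) (auto simp: refutes_def holds_def Cons_eq_map_conv)
  then show ?thesis by (metis in_set_conv_nth)
qed

lemma refutes_Box:
  assumes "inf_proof t" "refutes x t" "is_BoxRule (label t)"
  shows "\<exists>i < length (prems t). \<exists>y. refutes y (prems t ! i)"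
  using inf_proof_inference[OF assms(1)]
proof (cases rule: inference.cases)
  case (Box \<Sigma>\<^sub>0 \<Sigma>' \<Lambda> \<Pi> A \<Phi> \<Psi>)
  then obtain u where u: "prems t = [u]" "concl u = (\<Sigma>', mset_set \<Sigma>\<^sub>0 + \<Lambda> + \<Pi> + image_mset BoxP \<Pi>, {#A#})"
    by (auto simp: Cons_eq_map_conv)
  have [simp]: "\<Sigma>' = \<Sigma>" using Box assms(2) by (simp add: refutes_def)
  have "x \<in> N (holds (mset_set \<Sigma>\<^sub>0 + \<Lambda> + \<Pi> + image_mset BoxP \<Pi>))" "x \<notin> N (sm A)"
    using Box assms(2) holds_modal_context[of \<Sigma>\<^sub>0 x \<Phi> \<Lambda> \<Pi>] by (auto simp: refutes_def)
  then obtain y where "y \<in> holds (mset_set \<Sigma>\<^sub>0 + \<Lambda> + \<Pi> + image_mset BoxP \<Pi>)" "y \<notin> sm A"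
    using N_mono by blast
  then show ?thesis using u by (auto simp: refutes_def)
qed (use assms(3) in auto)

text \<open>The whole set \<open>U\<close> is returned and not a chosen point, because
  \<open>soundness\<close> has to place all of it inside a candidate post-fixed point before it can
  use monotonicity of \<open>N\<close>.\<close>

lemma refutes_BoxP:
  assumes "inf_proof t" "refutes x t" "is_BoxPRule (label t)"
  obtains l r U where "prems t = [l, r]" "x \<in> N U" "x \<notin> sm (BoxP (body (label t)))"
    "\<And>y. y \<in> U \<Longrightarrow> y \<in> sm (body (label t)) \<or> refutes y l"
    "\<And>y. y \<in> U \<Longrightarrow> y \<in> sm (BoxP (body (label t))) \<or> refutes y r"
  using inf_proof_inference[OF assms(1)]
proof (cases rule: inference.cases)
  case (BoxP \<Sigma>\<^sub>0 \<Sigma>' \<Lambda> \<Pi> A \<Phi> \<Psi>)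
  let ?C = "mset_set \<Sigma>\<^sub>0 + \<Lambda> + \<Pi> + image_mset BoxP \<Pi>"
  obtain l r where u: "prems t = [l, r]" "concl l = (\<Sigma>', ?C, {#A#})" "concl r = (\<Sigma>', ?C, {#BoxP A#})"
    using BoxP by (auto simp: Cons_eq_map_conv)
  have [simp]: "\<Sigma>' = \<Sigma>" using BoxP assms(2) by (simp add: refutes_def)
  have "x \<in> N (holds ?C)" "x \<notin> sm (BoxP A)"
    using BoxP assms(2) holds_modal_context[of \<Sigma>\<^sub>0 x \<Phi> \<Lambda> \<Pi>] by (auto simp: refutes_def)
  then show ?thesis using u BoxP by (intro that[of l r "holds ?C"]) (auto simp: refutes_def)
qed (use assms(3) in auto)

definition refuted :: "tree \<Rightarrow> bool" where
  "refuted t \<longleftrightarrow> inf_proof t \<and> (\<exists>x. refutes x t)"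

lemma refuted_BoxP:
  assumes "refuted t" "is_BoxPRule (label t)"
  obtains l r where "prems t = [l, r]" "refuted l \<or> refuted r"
proof -
  obtain x where t: "inf_proof t" "refutes x t" using assms(1) by (auto simp: refuted_def)
  let ?A = "body (label t)"
  obtain l r U where p: "prems t = [l, r]" "x \<in> N U" "x \<notin> sm (BoxP ?A)"
    "\<And>y. y \<in> U \<Longrightarrow> y \<in> sm ?A \<or> refutes y l"
    "\<And>y. y \<in> U \<Longrightarrow> y \<in> sm (BoxP ?A) \<or> refutes y r"
    using refutes_BoxP[OF t assms(2)] by blast
  have "\<not> U \<subseteq> sm ?A \<inter> sm (BoxP ?A)" using p(2,3) N_mono sm_BoxP_unfold by blast
  then have "(\<exists>y. refutes y l) \<or> (\<exists>y. refutes y r)" using p by blast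
  moreover have "inf_proof l" "inf_proof r" using inf_proof_prem[OF t(1)] p(1) by auto
  ultimately show thesis using that p(1) by (auto simp: refuted_def)
qed

lemma refuted_prem:
  assumes "refuted t" shows "\<exists>i < length (prems t). refuted (prems t ! i)"
proof (cases "is_BoxPRule (label t)")
  case True
  with assms obtain l r where "prems t = [l, r]" "refuted l \<or> refuted r" by (rule refuted_BoxP)
  then show ?thesis by (auto simp: less_Suc_eq)
next
  case False
  obtain x where t: "inf_proof t" "refutes x t" using assms by (auto simp: refuted_def)
  obtain i y where i: "i < length (prems t)" "refutes y (prems t ! i)"
    using refutes_local[OF t] refutes_Box[OF t] False by blast
  moreover have "inf_proof (prems t ! i)" using t(1) nth_mem[OF i(1)] by (rule inf_proof_prem)
  ultimately show ?thesis unfolding refuted_def by blast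
qed

text \<open>A violation of \<open>F\<close> is a node at which a branch through refuted nodes can do something that
  a tail with principal formula \<open>\<box>\<^sup>+F\<close> must not do.\<close>

definition violation :: "fm \<Rightarrow> tree \<Rightarrow> bool" where
  "violation F t \<longleftrightarrow> is_BoxRule (label t) \<or>
     is_BoxPRule (label t) \<and> (body (label t) \<noteq> F \<or> refuted (prems t ! 0))"

primrec escapes :: "nat \<Rightarrow> fm \<Rightarrow> tree \<Rightarrow> bool" where
  "escapes 0 F t \<longleftrightarrow> violation F t"
| "escapes (Suc n) F t \<longleftrightarrow> (\<exists>i < length (prems t). refuted (prems t ! i) \<and> escapes n F (prems t ! i))"

text \<open>If violations were always reachable, then a branch of refuted nodes that always moves
  towards the nearest one, and updates \<open>F\<close> there, would not be good.\<close>

lemma exists_no_escape: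
  assumes "refuted t"
  obtains s F where "refuted s" "\<And>n. \<not> escapes n F s"
proof (rule ccontr)
  assume "\<not> thesis"
  with that have esc: "\<exists>n. escapes n F s" if "refuted s" for s F using that by blast
  \<comment> \<open>At a violation the branch meets a \<open>BoxRule\<close>, goes left, or adopts
    the body at hand as new candidate; elsewhere it keeps the candidate and comes strictly closer to
    a violation. By the last clause a candidate is only ever replaced by the body of the current
    node, so it is stable once it agrees with a tail.\<close>
  define R where "R s F i F' \<longleftrightarrow>
    (violation F s \<longrightarrow> is_BoxRule (label s) \<or> is_BoxPRule (label s) \<and>
        (i = 0 \<or> body (label s) \<noteq> F \<and> F' = body (label s))) \<and>
    (\<not> violation F s \<longrightarrow> F' = F \<and>
        (LEAST n. escapes n F (prems s ! i)) < (LEAST n. escapes n F s)) \<and>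
    (F' = F \<or> is_BoxPRule (label s) \<and> F' = body (label s))" for s F i F'
  have step: "\<exists>i F'. i < length (prems s) \<and> refuted (prems s ! i) \<and> R s F i F'"
    if s: "refuted s" for s F
  proof (cases "violation F s")
    case True
    show ?thesis
    proof (cases "is_BoxRule (label s)")
      case True
      then show ?thesis using refuted_prem[OF s] \<open>violation F s\<close> unfolding R_def by blast
    next
      case False
      then have b: "is_BoxPRule (label s)" using True by (simp add: violation_def)
      obtain l r where lr: "prems s = [l, r]" "refuted l \<or> refuted r"
        using refuted_BoxP[OF s b] .
      show ?thesis
      proof (cases "refuted l")
        case True
        then show ?thesis using lr b \<open>violation F s\<close>
          by (intro exI[of _ 0] exI[of _ F]) (auto simp: R_def)
      next
        case False
        then show ?thesis using lr b \<open>violation F s\<close>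
          by (intro exI[of _ 1] exI[of _ "body (label s)"]) (auto simp: R_def violation_def)
      qed
    qed
  next
    case False
    let ?n = "LEAST n. escapes n F s"
    have "escapes ?n F s" using esc[OF s] by (rule LeastI_ex)
    with False obtain m where m: "?n = Suc m" by (cases ?n) auto
    with \<open>escapes ?n F s\<close> obtain i where i: "i < length (prems s)" "refuted (prems s ! i)"
      "escapes m F (prems s ! i)" by auto
    have "(LEAST n. escapes n F (prems s ! i)) \<le> m" by (rule Least_le) (rule i(3))
    then show ?thesis using i False m unfolding R_def
      by (intro exI[of _ i] exI[of _ F]) auto
  qed
  \<comment> \<open>\<open>Bot\<close> is an arbitrary initial candidate; the first violation inside
    a good tail replaces it.\<close>
  obtain d f where d: "infinite_branch t d" and r: "\<And>n. refuted (node_at t d n)"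
    and R: "\<And>n. R (node_at t d n) (f n) (d n) (f (Suc n))"
    using branch_by_choice[of "\<lambda>s _. refuted s" t Bot R] assms step by blast
  let ?s = "node_at t d"
  have inf: "\<exists>n\<ge>m. violation (f n) (?s n)" for m
  proof (induction "LEAST n. escapes n (f m) (?s m)" arbitrary: m rule: less_induct)
    case less
    show ?case
    proof (cases "violation (f m) (?s m)")
      case False
      then have "(LEAST n. escapes n (f (Suc m)) (?s (Suc m))) < (LEAST n. escapes n (f m) (?s m))"
        using R[of m] unfolding R_def by auto
      then show ?thesis using less[of "Suc m"] Suc_leD by blast
    qed auto
  qed
  have "inf_proof t" using assms by (simp add: refuted_def)
  then have "good_branch t d" using d by (simp add: inf_proof_def)
  then obtain K G where
    G: "\<And>n. n \<ge> K \<Longrightarrow> is_BoxPRule (label (?s n)) \<Longrightarrow> BoxP (body (label (?s n))) = G" and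
    L: "\<And>n. n \<ge> K \<Longrightarrow> \<not> (is_BoxPRule (label (?s n)) \<and> d n = 0)" and
    B: "\<And>n. n \<ge> K \<Longrightarrow> \<not> is_BoxRule (label (?s n))"
    unfolding good_branch_def by blast
  obtain n where n: "n \<ge> K" "violation (f n) (?s n)" using inf by blast
  then have bp: "is_BoxPRule (label (?s n))" "f (Suc n) = body (label (?s n))"
    using R[of n] L[of n] B[of n] unfolding R_def by auto
  \<comment> \<open>From here on the candidate is the common principal formula of the tail and
    cannot change, whereas a further violation would need a body different from it.\<close>
  have const: "BoxP (f (Suc (n + k))) = G" for k
  proof (induction k)
    case 0 show ?case using bp G n by simp
  next
    case (Suc k) then show ?case using R[of "Suc (n + k)"] G[of "Suc (n + k)"] n
      unfolding R_def by auto
  qed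
  obtain m where m: "m \<ge> Suc n" "violation (f m) (?s m)" using inf by blast
  obtain k where k: "m = Suc n + k" using le_Suc_ex[OF m(1)] by blast
  have "m \<ge> K" using m n by simp
  moreover from this have "is_BoxPRule (label (?s m)) \<and> body (label (?s m)) \<noteq> f m"
    using R[of m] L[of m] B[of m] m(2) unfolding R_def by blast
  ultimately show False using G[of m] const[of k] k by auto
qed

text \<open>Non-modal steps keep the point \<open>x\<close>. If they could go on forever inside
  \<open>C\<close>, they would form a branch without any \<open>BoxPRule\<close>, which is not
  good.\<close>

lemma reaches_modal:
  assumes "inf_proof t" "refutes x t" "t \<in> C"
    and closed: "\<And>s i. s \<in> C \<Longrightarrow> i < length (prems s) \<Longrightarrow> refuted (prems s ! i) \<Longrightarrow> prems s ! i \<in> C"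
    and noBox: "\<And>s. s \<in> C \<Longrightarrow> \<not> is_BoxRule (label s)"
  shows "\<exists>s \<in> C. inf_proof s \<and> refutes x s \<and> is_BoxPRule (label s)"
proof (rule ccontr)
  assume *: "\<not> ?thesis"
  let ?P = "\<lambda>s (_::unit). s \<in> C \<and> inf_proof s \<and> refutes x s"
  have step: "\<exists>i a. i < length (prems s) \<and> ?P (prems s ! i) a \<and> True" if s: "?P s b" for s and b :: unit
  proof -
    have "\<not> is_BoxPRule (label s)" "\<not> is_BoxRule (label s)" using * s noBox by auto
    then obtain i where i: "i < length (prems s)" "refutes x (prems s ! i)"
      using refutes_local s by blast
    moreover have "inf_proof (prems s ! i)" using s i inf_proof_prem by auto
    ultimately show ?thesis using closed s unfolding refuted_def by blast
  qed
  have "?P t ()" using assms(1-3) by simp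
  then have "\<exists>d. infinite_branch t d \<and> (\<forall>n. ?P (node_at t d n) ())"
    using step by (rule branch_by_choice[where P = ?P and R = "\<lambda>_ _ _ _. True"]) auto
  then obtain d where d: "infinite_branch t d" "\<And>n. ?P (node_at t d n) ()" by blast
  then have "good_branch t d" using assms(1) by (simp add: inf_proof_def)
  then obtain n where "is_BoxPRule (label (node_at t d n))"
    unfolding good_branch_def INFM_nat by blast
  then show False using * d(2) by blast
qed

theorem soundness: "\<not> refuted t"
proof
  assume "refuted t"
  then obtain s0 F where s0: "refuted s0" "\<And>n. \<not> escapes n F s0" by (rule exists_no_escape) blast
  define C where "C = {s. refuted s \<and> (\<forall>n. \<not> escapes n F s)}"
  have closed: "prems s ! i \<in> C" if "s \<in> C" "i < length (prems s)" "refuted (prems s ! i)" for s i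
    using that escapes.simps(2) unfolding C_def by blast
  have viol: "\<not> violation F s" if "s \<in> C" for s
    using that escapes.simps(1) unfolding C_def by blast
  define Z where "Z = {x. \<exists>s \<in> C. refutes x s}"
  have modal: "\<exists>s \<in> C. inf_proof s \<and> refutes x s \<and> is_BoxPRule (label s)" if x: "x \<in> Z" for x
  proof -
    obtain s where s: "s \<in> C" "refutes x s" using x by (auto simp: Z_def)
    moreover have "inf_proof s" using s by (auto simp: C_def refuted_def)
    ultimately show ?thesis
      by (intro reaches_modal closed) (use viol in \<open>auto simp: violation_def\<close>)
  qed
  \<comment> \<open>A point of \<open>U\<close> that refutes the right premise is again in
    \<open>Z\<close>, since \<open>C\<close> is closed; the others satisfy \<open>BoxP F\<close>.
    Joining \<open>sm (BoxP F)\<close>, itself a fixed point, absorbs the latter and keeps the set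
    post-fixed.\<close>
  let ?W = "Z \<union> sm (BoxP F)"
  have Z: "x \<in> N (sm F \<inter> ?W) \<and> x \<notin> sm (BoxP F)" if x: "x \<in> Z" for x
  proof -
    obtain s where s: "s \<in> C" "inf_proof s" "refutes x s" "is_BoxPRule (label s)"
      using modal[OF x] by blast
    have F: "body (label s) = F" "\<not> refuted (prems s ! 0)"
      using viol[OF s(1)] s(4) by (auto simp: violation_def)
    obtain l r U where p: "prems s = [l, r]" "x \<in> N U" "x \<notin> sm (BoxP F)"
      "\<And>y. y \<in> U \<Longrightarrow> y \<in> sm F \<or> refutes y l"
      "\<And>y. y \<in> U \<Longrightarrow> y \<in> sm (BoxP F) \<or> refutes y r"
      using refutes_BoxP[OF s(2-4)] F by metis
    have pr: "inf_proof l" "inf_proof r" using inf_proof_prem[OF s(2)] p(1) by auto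
    have "U \<subseteq> sm F \<inter> ?W"
    proof
      fix y assume y: "y \<in> U"
      have "y \<in> sm F" using p(1) p(4)[OF y] F(2) pr by (auto simp: refuted_def)
      moreover have "y \<in> Z" if "refutes y r"
        using closed[OF s(1), of 1] p(1) pr that by (auto simp: Z_def refuted_def)
      ultimately show "y \<in> sm F \<inter> ?W" using p(5)[OF y] by blast
    qed
    then show ?thesis using p(2,3) N_mono by blast
  qed
  have "sm (BoxP F) \<subseteq> N (sm F \<inter> ?W)"
    using sm_BoxP_unfold N_mono[of "sm F \<inter> sm (BoxP F)" "sm F \<inter> ?W"] by blast
  then have "?W \<subseteq> sm (BoxP F)" using Z by (intro sm_BoxP_coinduct) blast
  moreover obtain x where "x \<in> Z" using s0 unfolding Z_def C_def refuted_def by blast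
  ultimately show False using Z by blast
qed

end

section \<open>Building slim cut-free proofs\<close>

definition allowed :: "label \<Rightarrow> bool" where
  "allowed l \<longleftrightarrow> l \<noteq> Cut \<and> (is_BoxRule l \<or> is_BoxPRule l \<longrightarrow>
     no_repetitions (lambda_part l) \<and> no_repetitions (pi_part l))"

definition good_proof :: "tree \<Rightarrow> bool" where
  "good_proof t \<longleftrightarrow> inf_proof t \<and> slim t \<and> cut_free t"

definition derivable :: "sequent \<Rightarrow> bool" where
  "derivable S \<longleftrightarrow> (\<exists>t. good_proof t \<and> concl t = S)"

lemma good_proof_prem: "good_proof t \<Longrightarrow> u \<in> set (prems t) \<Longrightarrow> good_proof u"
  using inf_proof_prem subtrees_prem unfolding good_proof_def slim_def cut_free_def by blast

lemma good_proof_allowed: "good_proof t \<Longrightarrow> allowed (label t)"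
  using subtrees.self unfolding good_proof_def slim_def cut_free_def allowed_def by blast

lemma good_proofI:
  assumes "\<And>s. s \<in> subtrees t \<Longrightarrow> inference (label s) (map concl (prems s)) (concl s) \<and> allowed (label s)"
    and "\<And>d. infinite_branch t d \<Longrightarrow> good_branch t d"
  shows "good_proof t"
  using assms
  unfolding good_proof_def inf_proof_def built_by_rules_def slim_def cut_free_def allowed_def by blast

lemma derivable_inference:
  assumes "derivable S"
  obtains l Ps where "inference l Ps S" "allowed l" "\<forall>P \<in> set Ps. derivable P"
proof -
  obtain t where t: "good_proof t" "concl t = S" using assms by (auto simp: derivable_def)
  then have "inference (label t) (map concl (prems t)) S"
    using inf_proof_inference by (auto simp: good_proof_def)
  moreover have "\<forall>P \<in> set (map concl (prems t)). derivable P"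
    using good_proof_prem[OF t(1)] by (auto simp: derivable_def)
  ultimately show thesis using good_proof_allowed[OF t(1)] that by blast
qed

text \<open>An \<open>Inr\<close> seed is a sequent still to be expanded, an \<open>Inl\<close> seed
  a finished tree to be copied. The sum type thus lets finished proofs be spliced into a corecursive
  one.\<close>

primcorec unfold_tree :: "(sequent \<Rightarrow> label) \<Rightarrow> (sequent \<Rightarrow> (tree + sequent) list) \<Rightarrow> tree + sequent \<Rightarrow> tree" where
  "concl (unfold_tree lab succs x) = (case x of Inl t \<Rightarrow> concl t | Inr S \<Rightarrow> S)"
| "label (unfold_tree lab succs x) = (case x of Inl t \<Rightarrow> label t | Inr S \<Rightarrow> lab S)"
| "prems (unfold_tree lab succs x) = map (unfold_tree lab succs)
     (case x of Inl t \<Rightarrow> map Inl (prems t) | Inr S \<Rightarrow> succs S)"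

lemma unfold_tree_Inl: "unfold_tree lab succs (Inl t) = t"
proof (coinduction arbitrary: t)
  case Eq_tree
  then show ?case by (auto simp: list.rel_map intro!: list.rel_refl_strong)
qed

definition sequent_size :: "sequent \<Rightarrow> nat" where
  "sequent_size S = (case S of (\<Sigma>, \<Gamma>, \<Delta>) \<Rightarrow> sum_mset (image_mset size \<Gamma>) + sum_mset (image_mset size \<Delta>))"

lemma Imp_rules_decrease:
  assumes "inference l Ps S" "l = ImpL \<or> l = ImpR" "P \<in> set Ps"
  shows "sequent_size P < sequent_size S"
  using assms by (cases rule: inference.cases) (auto simp: sequent_size_def)

text \<open>A least fixed point (\<open>derivable\<close>) around a greatest one (\<open>Q\<close>). Since \<open>\<rightarrow>\<close>-rules decrease the
  size, an infinite branch staying in \<open>Q\<close> takes right premises of \<open>\<box>\<^sup>+B\<close> infinitely often.\<close>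

lemma derivable_coinduct:
  assumes "Q S"
    and step: "\<And>S. Q S \<Longrightarrow> \<exists>l Ps. inference l Ps S \<and> allowed l \<and>
      ((\<forall>P \<in> set Ps. derivable P) \<or>
       (l = ImpL \<or> l = ImpR) \<and> (\<forall>P \<in> set Ps. derivable P \<or> Q P) \<or>
       (\<exists>\<Lambda> \<Pi> P1 P2. l = BoxPRule \<Lambda> \<Pi> B \<and> Ps = [P1, P2] \<and> derivable P1 \<and> Q P2))"
  shows "derivable S"
proof -
  define W where "W S l Ps \<longleftrightarrow> inference l Ps S \<and> allowed l \<and>
      ((\<forall>P \<in> set Ps. derivable P) \<or>
       (l = ImpL \<or> l = ImpR) \<and> (\<forall>P \<in> set Ps. derivable P \<or> Q P) \<or>
       (\<exists>\<Lambda> \<Pi> P1 P2. l = BoxPRule \<Lambda> \<Pi> B \<and> Ps = [P1, P2] \<and> derivable P1 \<and> Q P2))" for S l Ps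
  have "\<exists>l Ps. W S l Ps" if "Q S" for S using step[OF that] unfolding W_def .
  then obtain lab Ps where W: "\<And>S. Q S \<Longrightarrow> W S (lab S) (Ps S)" by metis
  note inf = W[unfolded W_def, THEN conjunct1]
    and al = W[unfolded W_def, THEN conjunct2, THEN conjunct1]
    and cases = W[unfolded W_def, THEN conjunct2, THEN conjunct2]
  define p where "p S = (SOME t. good_proof t \<and> concl t = S)" for S
  have p: "good_proof (p S) \<and> concl (p S) = S" if "derivable S" for S
    unfolding p_def using that unfolding derivable_def by (rule someI_ex)
  \<comment> \<open>A derivable premise is closed at once by its chosen proof. A branch that never
    enters such a proof therefore meets only underivable sequents after the root; the root is
    expanded even when it is derivable.\<close>
  define nxt where "nxt S = (if derivable S then Inl (p S) else Inr S)" for S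
  define g where "g = unfold_tree lab (\<lambda>S. map nxt (Ps S))"
  have g_Inl: "g (Inl t) = t" for t by (simp add: g_def unfold_tree_Inl)
  have g_concl: "concl (g (nxt S)) = S" for S
    using p by (auto simp: g_def nxt_def)
  have g_Inr: "label (g (Inr S)) = lab S" "prems (g (Inr S)) = map (\<lambda>S. g (nxt S)) (Ps S)"
    "concl (g (Inr S)) = S" for S by (auto simp: g_def)
  have next_Q: "good_proof (g (nxt P)) \<or> (nxt P = Inr P \<and> Q P \<and> \<not> derivable P)" if "Q S" "P \<in> set (Ps S)" for S P
  proof -
    have "derivable P \<or> Q P" using cases[OF that(1)] that(2) by auto
    then show ?thesis using p by (auto simp: nxt_def g_Inl)
  qed
  have subs: "good_proof s \<or> (\<exists>S'. s = g (Inr S') \<and> Q S')" if "s \<in> subtrees (g (Inr S))" for s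
    using that
  proof (induction rule: subtrees.induct)
    case self then show ?case using assms(1) by blast
  next
    case (prem s u)
    then show ?case
    proof (elim disjE exE conjE)
      assume "good_proof s"
      then show ?thesis using good_proof_prem prem by blast
    next
      fix S' assume S': "s = g (Inr S')" "Q S'"
      then obtain P where "P \<in> set (Ps S')" "u = g (nxt P)" using prem(2) by (auto simp: g_Inr)
      then show ?thesis using next_Q S' by metis
    qed
  qed
  have "good_proof (g (Inr S))"
  proof (rule good_proofI)
    fix s assume "s \<in> subtrees (g (Inr S))"
    then consider "good_proof s" | S' where "s = g (Inr S')" "Q S'" using subs by blast
    then show "inference (label s) (map concl (prems s)) (concl s) \<and> allowed (label s)"
    proof cases
      case 1 then show ?thesis
        using inf_proof_inference good_proof_allowed by (simp add: good_proof_def)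
    next
      case 2 then show ?thesis
        using inf al by (simp add: g_Inr o_def g_concl)
    qed
  next
    fix d assume d: "infinite_branch (g (Inr S)) d"
    let ?s = "node_at (g (Inr S)) d"
    show "good_branch (g (Inr S)) d"
    proof (cases "\<exists>n. good_proof (?s n)")
      case True
      then obtain n where "good_proof (?s n)" by blast
      then have "good_branch (?s n) (\<lambda>k. d (n + k))"
        using infinite_branch_shift[OF d] by (simp add: good_proof_def inf_proof_def)
      then show ?thesis by (rule good_branch_unshift)
    next
      case False
      have Q: "\<exists>S'. ?s n = g (Inr S') \<and> Q S'" for n
      proof (induction n)
        case 0 show ?case using assms(1) by (intro exI[of _ S]) simp
      next
        case (Suc n)
        then obtain S' where S': "?s n = g (Inr S')" "Q S'" by blast
        have len: "d n < length (Ps S')" using d S' by (auto simp: infinite_branch_def g_Inr dest: spec[of _ n])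
        then have "?s (Suc n) = g (nxt (Ps S' ! d n))" using S' by (simp add: g_Inr)
        then show ?case using next_Q[OF S'(2), of "Ps S' ! d n"] len False by (metis nth_mem)
      qed
      define c where "c n = concl (?s n)" for n
      have c: "?s n = g (Inr (c n))" "Q (c n)" for n
        using Q[of n] by (auto simp: c_def g_Inr)
      have len: "d n < length (Ps (c n))" for n
        using d c(1)[of n] by (auto simp: infinite_branch_def g_Inr dest: spec[of _ n])
      have c_Suc: "c (Suc n) = Ps (c n) ! d n" for n
        using len[of n] c(1)[of n] g_concl by (simp add: c_def[of "Suc n"] g_Inr)
      have npr: "\<not> derivable (c n)" if "n > 0" for n
      proof
        assume derivable: "derivable (c n)"
        from that obtain m where m: "n = Suc m" by (cases n) auto
        have "?s n = g (nxt (c n))" using c(1)[of m] len[of m] c_Suc[of m] by (simp add: m g_Inr)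
        then show False using derivable p False by (metis g_Inl nxt_def)
      qed
      \<comment> \<open>The next sequent is underivable, which excludes both a node with only
        derivable premises and the left premise of a \<open>BoxPRule\<close>.\<close>
      have alt: "lab (c n) = ImpL \<or> lab (c n) = ImpR \<or> (\<exists>\<Lambda> \<Pi>. lab (c n) = BoxPRule \<Lambda> \<Pi> B \<and> d n = 1)" for n
      proof -
        have "\<not> derivable (Ps (c n) ! d n)" using npr[of "Suc n"] c_Suc by simp
        then show ?thesis using cases[OF c(2)[of n]] len[of n] by (auto simp: less_Suc_eq)
      qed
      have "\<exists>n\<ge>m. lab (c n) \<noteq> ImpL \<and> lab (c n) \<noteq> ImpR" for m
      proof (induction "sequent_size (c m)" arbitrary: m rule: less_induct)
        case less
        show ?case
        proof (cases "lab (c m) = ImpL \<or> lab (c m) = ImpR")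
          case True
          have "sequent_size (c (Suc m)) < sequent_size (c m)"
            using Imp_rules_decrease[OF inf[OF c(2)] True] c_Suc len by simp
          then show ?thesis using less[of "Suc m"] Suc_leD by blast
        qed auto
      qed
      then have "\<exists>n>m. lab (c n) \<noteq> ImpL \<and> lab (c n) \<noteq> ImpR" for m
        using less_eq_Suc_le by blast
      moreover have "is_BoxPRule (lab (c n)) \<and> d n = 1" if "lab (c n) \<noteq> ImpL \<and> lab (c n) \<noteq> ImpR" for n
        using alt[of n] that by auto
      ultimately have "\<exists>n>m. is_BoxPRule (lab (c n)) \<and> d n = 1" for m by blast
      then have "\<exists>\<^sub>\<infinity>n. is_BoxPRule (lab (c n)) \<and> d n = 1" unfolding INFM_nat by blast
      moreover have "is_BoxPRule (lab (c n)) \<Longrightarrow> body (lab (c n)) = B \<and> d n = 1"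
        "\<not> is_BoxRule (lab (c n))" for n using alt[of n] by auto
      moreover have "label (?s n) = lab (c n)" for n using c(1) g_Inr(1) by metis
      ultimately show ?thesis unfolding good_branch_def
        by (intro exI[of _ 0] conjI exI[of _ "BoxP B"]) auto
    qed
  qed
  then show ?thesis unfolding derivable_def using g_Inr(3) by blast
qed

lemma derivable_rule:
  assumes "inference l Ps S" "allowed l" "\<forall>P \<in> set Ps. derivable P"
  shows "derivable S"
  by (rule derivable_coinduct[of "\<lambda>S'. S' = S"]) (use assms in auto)

section \<open>The canonical frame\<close>

text \<open>A point is a pair \<open>(L, R)\<close> of sets of formulas, thought of as true and false. Requiring
  unprovability only of the premises of modal rules avoids any appeal to contraction.\<close>

definition modal_context :: "fm set \<Rightarrow> fm set \<Rightarrow> fm set \<Rightarrow> fm multiset" where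
  "modal_context S\<^sub>0 \<Lambda> \<Pi> = mset_set S\<^sub>0 + mset_set \<Lambda> + mset_set \<Pi> + image_mset BoxP (mset_set \<Pi>)"

definition admissible :: "fm set \<Rightarrow> fm set \<Rightarrow> fm set \<Rightarrow> fm set \<Rightarrow> fm set \<Rightarrow> bool" where
  "admissible \<Sigma> L S\<^sub>0 \<Lambda> \<Pi> \<longleftrightarrow> finite S\<^sub>0 \<and> finite \<Lambda> \<and> finite \<Pi> \<and> S\<^sub>0 \<subseteq> \<Sigma> \<and>
     Box ` \<Lambda> \<subseteq> L \<and> BoxP ` \<Pi> \<subseteq> L"

text \<open>Saturated but not maximal: a formula may be in neither \<open>L\<close> nor
  \<open>R\<close>, so extending a sequent to a world does not call for cut. For
  \<open>BoxP A\<close> the two premises must not be derivable together, which leaves open which of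
  them fails.\<close>

definition world :: "fm set \<Rightarrow> fm set \<times> fm set \<Rightarrow> bool" where
  "world \<Sigma> = (\<lambda>(L, R). Bot \<notin> L \<and> (\<forall>p. \<not> (Var p \<in> L \<and> Var p \<in> R)) \<and>
     (\<forall>A B. Imp A B \<in> L \<longrightarrow> B \<in> L \<or> A \<in> R) \<and>
     (\<forall>A B. Imp A B \<in> R \<longrightarrow> A \<in> L \<and> B \<in> R) \<and>
     (\<forall>S\<^sub>0 \<Lambda> \<Pi> A. admissible \<Sigma> L S\<^sub>0 \<Lambda> \<Pi> \<longrightarrow>
        (Box A \<in> R \<longrightarrow> \<not> derivable (\<Sigma>, modal_context S\<^sub>0 \<Lambda> \<Pi>, {#A#})) \<and>
        (BoxP A \<in> R \<longrightarrow> \<not> (derivable (\<Sigma>, modal_context S\<^sub>0 \<Lambda> \<Pi>, {#A#}) \<and>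
           derivable (\<Sigma>, modal_context S\<^sub>0 \<Lambda> \<Pi>, {#BoxP A#})))))"

text \<open>The neighbourhoods of a pair are generated by the possible premise contexts of a modal
  rule with its boxed formulas on the left. Pairs that are not worlds also belong to the frame, but
  \<open>U\<close> is tested on worlds alone.\<close>

definition canon_N :: "fm set \<Rightarrow> (fm set \<times> fm set) set \<Rightarrow> (fm set \<times> fm set) set" where
  "canon_N \<Sigma> U = {(L, R). \<exists>S\<^sub>0 \<Lambda> \<Pi>. admissible \<Sigma> L S\<^sub>0 \<Lambda> \<Pi> \<and>
     (\<forall>L' R'. world \<Sigma> (L', R') \<longrightarrow> set_mset (modal_context S\<^sub>0 \<Lambda> \<Pi>) \<subseteq> L' \<longrightarrow> (L', R') \<in> U)}"

definition canon_v :: "nat \<Rightarrow> (fm set \<times> fm set) set" where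
  "canon_v p = {(L, R). Var p \<in> L}"

lemma set_modal_context:
  "finite S\<^sub>0 \<Longrightarrow> finite \<Lambda> \<Longrightarrow> finite \<Pi> \<Longrightarrow>
    set_mset (modal_context S\<^sub>0 \<Lambda> \<Pi>) = S\<^sub>0 \<union> \<Lambda> \<union> \<Pi> \<union> BoxP ` \<Pi>"
  by (simp add: modal_context_def)

lemma set_modal_context_admissible:
  "admissible \<Sigma> L S\<^sub>0 \<Lambda> \<Pi> \<Longrightarrow> set_mset (modal_context S\<^sub>0 \<Lambda> \<Pi>) = S\<^sub>0 \<union> \<Lambda> \<union> \<Pi> \<union> BoxP ` \<Pi>"
  by (auto simp: set_modal_context admissible_def)

lemma canon_NI:
  assumes "admissible \<Sigma> L S\<^sub>0 \<Lambda> \<Pi>"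
    and "\<And>L' R'. world \<Sigma> (L', R') \<Longrightarrow> S\<^sub>0 \<union> \<Lambda> \<union> \<Pi> \<union> BoxP ` \<Pi> \<subseteq> L' \<Longrightarrow> (L', R') \<in> U"
  shows "(L, R) \<in> canon_N \<Sigma> U"
  unfolding canon_N_def using assms set_modal_context_admissible[OF assms(1)] by blast

lemma canon_NE:
  assumes "(L, R) \<in> canon_N \<Sigma> U"
  obtains S\<^sub>0 \<Lambda> \<Pi> where "admissible \<Sigma> L S\<^sub>0 \<Lambda> \<Pi>"
    "\<And>L' R'. world \<Sigma> (L', R') \<Longrightarrow> set_mset (modal_context S\<^sub>0 \<Lambda> \<Pi>) \<subseteq> L' \<Longrightarrow> (L', R') \<in> U"
  using assms unfolding canon_N_def by blast

lemma canon_N_mono: "U \<subseteq> V \<Longrightarrow> canon_N \<Sigma> U \<subseteq> canon_N \<Sigma> V"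
  unfolding canon_N_def by blast

text \<open>Only boxed members of \<open>L\<close> matter, so an implication added by saturation can
  be taken away again. This carries the invariant of \<open>derivable_BoxP\<close> through the
  \<rightarrow>-rules.\<close>

lemma canon_N_boxed:
  assumes "(L, R) \<in> canon_N \<Sigma> U"
    and "\<And>A. Box A \<in> L \<Longrightarrow> Box A \<in> L'" "\<And>A. BoxP A \<in> L \<Longrightarrow> BoxP A \<in> L'"
  shows "(L', R') \<in> canon_N \<Sigma> U"
proof -
  have "admissible \<Sigma> L S\<^sub>0 \<Lambda> \<Pi> \<Longrightarrow> admissible \<Sigma> L' S\<^sub>0 \<Lambda> \<Pi>" for S\<^sub>0 \<Lambda> \<Pi>
    using assms(2,3) by (simp add: admissible_def image_subset_iff)
  then show ?thesis using assms(1) unfolding canon_N_def by blast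
qed

lemma canon_N_Int: "canon_N \<Sigma> U \<inter> canon_N \<Sigma> V \<subseteq> canon_N \<Sigma> (U \<inter> V)"
proof (clarify)
  fix L R assume "(L, R) \<in> canon_N \<Sigma> U" "(L, R) \<in> canon_N \<Sigma> V"
  then obtain S1 L1 P1 S2 L2 P2 where
    1: "admissible \<Sigma> L S1 L1 P1"
    "\<And>L' R'. world \<Sigma> (L', R') \<Longrightarrow> set_mset (modal_context S1 L1 P1) \<subseteq> L' \<Longrightarrow> (L', R') \<in> U" and
    2: "admissible \<Sigma> L S2 L2 P2"
    "\<And>L' R'. world \<Sigma> (L', R') \<Longrightarrow> set_mset (modal_context S2 L2 P2) \<subseteq> L' \<Longrightarrow> (L', R') \<in> V"
    by (elim canon_NE) blast
  show "(L, R) \<in> canon_N \<Sigma> (U \<inter> V)"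
  proof (rule canon_NI)
    show "admissible \<Sigma> L (S1 \<union> S2) (L1 \<union> L2) (P1 \<union> P2)"
      using 1(1) 2(1) by (auto simp: admissible_def)
    fix L' R' assume w: "world \<Sigma> (L', R')"
      "S1 \<union> S2 \<union> (L1 \<union> L2) \<union> (P1 \<union> P2) \<union> BoxP ` (P1 \<union> P2) \<subseteq> L'"
    then show "(L', R') \<in> U \<inter> V"
      using 1(2)[OF w(1)] 2(2)[OF w(1)]
      unfolding set_modal_context_admissible[OF 1(1)] set_modal_context_admissible[OF 2(1)] by blast
  qed
qed

text \<open>The source of slimness: \<open>mset_set\<close> counts each element at most
  once.\<close>

lemma allowed_modal:
  "allowed (BoxRule (mset_set \<Lambda>) (mset_set \<Pi>) A)" "allowed (BoxPRule (mset_set \<Lambda>) (mset_set \<Pi>) A)"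
  by (auto simp: allowed_def no_repetitions_def count_mset_set')

text \<open>The images under \<open>Box\<close> and \<open>BoxP\<close> are disjoint and without
  repetitions, so their sum is the multiset of a set of members of \<Gamma> and hence contained in
  \<Gamma>; \<Phi> is the rest.\<close>

lemma admissible_decompose:
  assumes "admissible \<Sigma> (set_mset \<Gamma>) S\<^sub>0 \<Lambda> \<Pi>"
  obtains \<Phi> where "\<Gamma> = \<Phi> + image_mset Box (mset_set \<Lambda>) + image_mset BoxP (mset_set \<Pi>)"
proof -
  have fin: "finite \<Lambda>" "finite \<Pi>" and sub: "Box ` \<Lambda> \<union> BoxP ` \<Pi> \<subseteq> set_mset \<Gamma>"
    using assms by (auto simp: admissible_def)
  have "image_mset Box (mset_set \<Lambda>) + image_mset BoxP (mset_set \<Pi>) = mset_set (Box ` \<Lambda>) + mset_set (BoxP ` \<Pi>)"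
    by (simp add: image_mset_mset_set inj_on_def)
  also have "\<dots> = mset_set (Box ` \<Lambda> \<union> BoxP ` \<Pi>)"
    using fin by (intro mset_set_Union[symmetric]) auto
  also have "\<dots> \<subseteq># mset_set (set_mset \<Gamma>)"
    using sub fin by (intro subset_imp_msubset_mset_set) auto
  also have "\<dots> \<subseteq># \<Gamma>" by (rule mset_set_set_mset_msubset)
  finally obtain \<Phi> where "\<Gamma> = image_mset Box (mset_set \<Lambda>) + image_mset BoxP (mset_set \<Pi>) + \<Phi>"
    by (auto simp: mset_subset_eq_exists_conv)
  then show thesis by (intro that[of \<Phi>]) (simp add: add_ac)
qed

lemma inference_Box:
  assumes "admissible \<Sigma> (set_mset \<Gamma>) S\<^sub>0 \<Lambda> \<Pi>" "Box A \<in># \<Delta>"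
  shows "inference (BoxRule (mset_set \<Lambda>) (mset_set \<Pi>) A) [(\<Sigma>, modal_context S\<^sub>0 \<Lambda> \<Pi>, {#A#})] (\<Sigma>, \<Gamma>, \<Delta>)"
proof -
  obtain \<Psi> where "\<Delta> = add_mset (Box A) \<Psi>" using assms(2) by (metis mset_add)
  moreover obtain \<Phi> where "\<Gamma> = \<Phi> + image_mset Box (mset_set \<Lambda>) + image_mset BoxP (mset_set \<Pi>)"
    using admissible_decompose[OF assms(1)] .
  ultimately show ?thesis using assms(1) inference.Box unfolding modal_context_def admissible_def by simp
qed

lemma inference_BoxP:
  assumes "admissible \<Sigma> (set_mset \<Gamma>) S\<^sub>0 \<Lambda> \<Pi>" "BoxP A \<in># \<Delta>"
  shows "inference (BoxPRule (mset_set \<Lambda>) (mset_set \<Pi>) A)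
    [(\<Sigma>, modal_context S\<^sub>0 \<Lambda> \<Pi>, {#A#}), (\<Sigma>, modal_context S\<^sub>0 \<Lambda> \<Pi>, {#BoxP A#})] (\<Sigma>, \<Gamma>, \<Delta>)"
proof -
  obtain \<Psi> where "\<Delta> = add_mset (BoxP A) \<Psi>" using assms(2) by (metis mset_add)
  moreover obtain \<Phi> where "\<Gamma> = \<Phi> + image_mset Box (mset_set \<Lambda>) + image_mset BoxP (mset_set \<Pi>)"
    using admissible_decompose[OF assms(1)] .
  ultimately show ?thesis using assms(1) inference.BoxP unfolding modal_context_def admissible_def by simp
qed

section \<open>Saturating underivable sequents\<close>

lemma irreducible_world:
  assumes "\<not> derivable (\<Sigma>, \<Gamma>, \<Delta>)" "\<And>A B. Imp A B \<notin># \<Gamma>" "\<And>A B. Imp A B \<notin># \<Delta>"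
  shows "world \<Sigma> (set_mset \<Gamma>, set_mset \<Delta>)"
proof -
  have ax: "\<not> inference Init [] (\<Sigma>, \<Gamma>, \<Delta>)"
    using assms(1) derivable_rule[of Init "[]"] by (auto simp: allowed_def)
  have "Bot \<notin># \<Gamma>" using ax init_Bot by (metis mset_add)
  moreover have "\<not> (Var p \<in># \<Gamma> \<and> Var p \<in># \<Delta>)" for p using ax init_Var by (metis mset_add)
  moreover have "\<not> derivable (\<Sigma>, modal_context S\<^sub>0 \<Lambda> \<Pi>, {#A#})"
    if "admissible \<Sigma> (set_mset \<Gamma>) S\<^sub>0 \<Lambda> \<Pi>" "Box A \<in># \<Delta>" for S\<^sub>0 \<Lambda> \<Pi> A
    using derivable_rule[OF inference_Box[OF that] allowed_modal(1)] assms(1) by auto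
  moreover have "\<not> (derivable (\<Sigma>, modal_context S\<^sub>0 \<Lambda> \<Pi>, {#A#}) \<and> derivable (\<Sigma>, modal_context S\<^sub>0 \<Lambda> \<Pi>, {#BoxP A#}))"
    if "admissible \<Sigma> (set_mset \<Gamma>) S\<^sub>0 \<Lambda> \<Pi>" "BoxP A \<in># \<Delta>" for S\<^sub>0 \<Lambda> \<Pi> A
    using derivable_rule[OF inference_BoxP[OF that] allowed_modal(2)] assms(1) by auto
  ultimately show ?thesis using assms(2,3) by (simp add: world_def)
qed

lemma world_insert_left:
  assumes "world \<Sigma> (L, R)" "B \<in> L \<or> A \<in> R"
  shows "world \<Sigma> (insert (Imp A B) L, R)"
  using assms by (auto simp: world_def admissible_def image_subset_iff)

lemma world_insert_right:
  assumes "world \<Sigma> (L, R)" "A \<in> L" "B \<in> R"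
  shows "world \<Sigma> (L, insert (Imp A B) R)"
  using assms by (auto simp: world_def)

text \<open>Bottom-up proof search by induction on the size. The reduced implication leaves the
  sequent, which makes the size drop, and is put back into the world afterwards.\<close>

lemma world_extends:
  assumes "\<not> derivable (\<Sigma>, \<Gamma>, \<Delta>)"
  obtains L R where "world \<Sigma> (L, R)" "set_mset \<Gamma> \<subseteq> L" "set_mset \<Delta> \<subseteq> R"
proof -
  have "\<exists>L R. world \<Sigma> (L, R) \<and> set_mset \<Gamma> \<subseteq> L \<and> set_mset \<Delta> \<subseteq> R"
    using assms
  proof (induction "sequent_size (\<Sigma>, \<Gamma>, \<Delta>)" arbitrary: \<Gamma> \<Delta> rule: less_induct)
    case less
    consider (L) A B \<Gamma>' where "\<Gamma> = add_mset (Imp A B) \<Gamma>'"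
      | (R) A B \<Delta>' where "\<Delta> = add_mset (Imp A B) \<Delta>'"
      | (irr) "\<And>A B. Imp A B \<notin># \<Gamma>" "\<And>A B. Imp A B \<notin># \<Delta>"
      by (metis mset_add)
    then show ?case
    proof cases
      case L
      note inf = inference.ImpL[of \<Sigma> B \<Gamma>' \<Delta> A, folded L]
      have "\<not> derivable (\<Sigma>, add_mset B \<Gamma>', \<Delta>) \<or> \<not> derivable (\<Sigma>, \<Gamma>', add_mset A \<Delta>)"
        using derivable_rule[OF inf] less.prems by (auto simp: allowed_def)
      then obtain L R where "world \<Sigma> (L, R)" "set_mset \<Gamma>' \<subseteq> L" "set_mset \<Delta> \<subseteq> R" "B \<in> L \<or> A \<in> R"
        using less.hyps[of "add_mset B \<Gamma>'" \<Delta>] less.hyps[of \<Gamma>' "add_mset A \<Delta>"]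
          Imp_rules_decrease[OF inf] by auto
      then show ?thesis using world_insert_left[of \<Sigma> L R B A] L
        by (intro exI[of _ "insert (Imp A B) L"] exI[of _ R]) auto
    next
      case R
      note inf = inference.ImpR[of \<Sigma> A \<Gamma> B \<Delta>', folded R]
      have "\<not> derivable (\<Sigma>, add_mset A \<Gamma>, add_mset B \<Delta>')"
        using derivable_rule[OF inf] less.prems by (auto simp: allowed_def)
      then obtain L R where "world \<Sigma> (L, R)" "set_mset \<Gamma> \<subseteq> L" "set_mset \<Delta>' \<subseteq> R" "A \<in> L" "B \<in> R"
        using less.hyps[of "add_mset A \<Gamma>" "add_mset B \<Delta>'"] Imp_rules_decrease[OF inf] by auto
      then show ?thesis using world_insert_right[of \<Sigma> L R A B] R
        by (intro exI[of _ L] exI[of _ "insert (Imp A B) R"]) auto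
    next
      case irr
      then show ?thesis using irreducible_world less.prems by blast
    qed
  qed
  then show thesis using that by blast
qed

text \<open>The sequents \<open>Q\<close> all of whose worlds lie in \<open>Z\<close> supply the greatest fixed point.\<close>

lemma derivable_BoxP:
  assumes Z: "Z = canon_N \<Sigma> (U \<inter> Z)"
    and U: "\<And>L R. world \<Sigma> (L, R) \<Longrightarrow> B \<in> R \<Longrightarrow> (L, R) \<notin> U"
    and "BoxP B \<in># \<Delta>"
    and "\<And>L R. world \<Sigma> (L, R) \<Longrightarrow> set_mset \<Gamma> \<subseteq> L \<Longrightarrow> set_mset \<Delta> \<subseteq> R \<Longrightarrow> (L, R) \<in> Z"
  shows "derivable (\<Sigma>, \<Gamma>, \<Delta>)"
proof -
  note ZD = equalityD1[OF Z, THEN subsetD] and ZI = equalityD2[OF Z, THEN subsetD]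
  define Q where "Q = (\<lambda>(\<Sigma>', \<Gamma>, \<Delta>). \<Sigma>' = \<Sigma> \<and> BoxP B \<in># \<Delta> \<and>
    (\<forall>L R. world \<Sigma> (L, R) \<longrightarrow> set_mset \<Gamma> \<subseteq> L \<longrightarrow> set_mset \<Delta> \<subseteq> R \<longrightarrow> (L, R) \<in> Z))"
  show ?thesis
  proof (rule derivable_coinduct[of Q _ B])
    show "Q (\<Sigma>, \<Gamma>, \<Delta>)" using assms(3,4) by (simp add: Q_def)
  next
    fix S assume "Q S"
    then obtain \<Gamma> \<Delta> where S: "S = (\<Sigma>, \<Gamma>, \<Delta>)" and B: "BoxP B \<in># \<Delta>" and
      sub: "\<And>L R. world \<Sigma> (L, R) \<Longrightarrow> set_mset \<Gamma> \<subseteq> L \<Longrightarrow> set_mset \<Delta> \<subseteq> R \<Longrightarrow> (L, R) \<in> Z"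
      by (auto simp: Q_def)
    let ?goal = "\<exists>l Ps. inference l Ps S \<and> allowed l \<and>
      ((\<forall>P \<in> set Ps. derivable P) \<or>
       (l = ImpL \<or> l = ImpR) \<and> (\<forall>P \<in> set Ps. derivable P \<or> Q P) \<or>
       (\<exists>\<Lambda> \<Pi> P1 P2. l = BoxPRule \<Lambda> \<Pi> B \<and> Ps = [P1, P2] \<and> derivable P1 \<and> Q P2))"
    consider (derivable) "derivable S" | (L) A C \<Gamma>' where "\<Gamma> = add_mset (Imp A C) \<Gamma>'"
      | (R) A C \<Delta>' where "\<Delta> = add_mset (Imp A C) \<Delta>'"
      | (irr) "\<not> derivable S" "\<And>A B. Imp A B \<notin># \<Gamma>" "\<And>A B. Imp A B \<notin># \<Delta>"
      by (metis mset_add)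
    then show ?goal
    proof cases
      case derivable
      then show ?thesis by (metis derivable_inference)
    next
      case L
      \<comment> \<open>A world extending a premise may lack the principal implication. Inserting it
        gives a world extending the conclusion, hence a member of \<open>Z\<close>; as it is not
        boxed, it can then be dropped.\<close>
      have Z_L: "(L, R) \<in> Z" if "(insert (Imp A C) L, R) \<in> Z" for L R
        by (rule ZI, rule canon_N_boxed[OF ZD[OF that]]) auto
      have "(L, R) \<in> Z" if "world \<Sigma> (L, R)" "set_mset \<Gamma>' \<subseteq> L" "set_mset \<Delta> \<subseteq> R" "C \<in> L \<or> A \<in> R" for L R
        by (rule Z_L, rule sub, rule world_insert_left) (use that L in auto)
      then have "Q (\<Sigma>, add_mset C \<Gamma>', \<Delta>)" "Q (\<Sigma>, \<Gamma>', add_mset A \<Delta>)"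
        using B by (auto simp: Q_def)
      then show ?thesis using inference.ImpL[of \<Sigma> C \<Gamma>' \<Delta> A] L S
        by (intro exI[of _ label.ImpL] exI conjI) (auto simp: allowed_def)
    next
      case R
      have Z_R: "(L, R) \<in> Z" if "(L, insert (Imp A C) R) \<in> Z" for L R
        by (rule ZI, rule canon_N_boxed[OF ZD[OF that]]) auto
      have "(L, R) \<in> Z" if "world \<Sigma> (L, R)" "set_mset \<Gamma> \<subseteq> L" "set_mset \<Delta>' \<subseteq> R" "A \<in> L" "C \<in> R" for L R
        by (rule Z_R, rule sub, rule world_insert_right) (use that R in auto)
      then have "Q (\<Sigma>, add_mset A \<Gamma>, add_mset C \<Delta>')"
        using B R by (auto simp: Q_def)
      then show ?thesis using inference.ImpR[of \<Sigma> A \<Gamma> C \<Delta>'] R S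
        by (intro exI[of _ label.ImpR] exI conjI) (auto simp: allowed_def)
    next
      case irr
      \<comment> \<open>An irreducible underivable sequent is a world extending itself, so the
        invariant applies to it. Unfolding \<open>Z\<close> there produces the context for
        \<open>BoxPRule\<close>: its worlds lie in \<open>U\<close>, which serves the left premise,
        and in \<open>Z\<close>, which serves the right one.\<close>
      then have "(set_mset \<Gamma>, set_mset \<Delta>) \<in> Z"
        using irreducible_world[of \<Sigma> \<Gamma> \<Delta>] sub S by auto
      then have "(set_mset \<Gamma>, set_mset \<Delta>) \<in> canon_N \<Sigma> (U \<inter> Z)" by (rule ZD)
      then obtain S\<^sub>0 \<Lambda> \<Pi> where adm: "admissible \<Sigma> (set_mset \<Gamma>) S\<^sub>0 \<Lambda> \<Pi>" and
        UZ: "\<And>L R. world \<Sigma> (L, R) \<Longrightarrow> set_mset (modal_context S\<^sub>0 \<Lambda> \<Pi>) \<subseteq> L \<Longrightarrow> (L, R) \<in> U \<inter> Z"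
        by (rule canon_NE) blast
      have "derivable (\<Sigma>, modal_context S\<^sub>0 \<Lambda> \<Pi>, {#B#})"
      proof (rule ccontr)
        assume "\<not> ?thesis"
        then obtain L R where w: "world \<Sigma> (L, R)" "set_mset (modal_context S\<^sub>0 \<Lambda> \<Pi>) \<subseteq> L" "set_mset {#B#} \<subseteq> R"
          by (rule world_extends)
        then show False using U[OF w(1)] UZ[OF w(1,2)] by auto
      qed
      moreover have "Q (\<Sigma>, modal_context S\<^sub>0 \<Lambda> \<Pi>, {#BoxP B#})" using UZ by (auto simp: Q_def)
      ultimately show ?thesis
        using inference_BoxP[OF adm B] allowed_modal(2) S by blast
    qed
  qed
qed

text \<open>Worlds need not decide every formula, hence two implications instead of an
  equivalence.\<close>

lemma truth:
  assumes "world \<Sigma> (L, R)"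
  shows "(A \<in> L \<longrightarrow> (L, R) \<in> sem (canon_N \<Sigma>) canon_v A) \<and>
    (A \<in> R \<longrightarrow> (L, R) \<notin> sem (canon_N \<Sigma>) canon_v A)"
  using assms
proof (induction A arbitrary: L R)
  case (Var p)
  then show ?case by (auto simp: world_def canon_v_def)
next
  case Bot
  then show ?case by (auto simp: world_def)
next
  case (Imp A B)
  have "Imp A B \<in> L \<Longrightarrow> B \<in> L \<or> A \<in> R" "Imp A B \<in> R \<Longrightarrow> A \<in> L \<and> B \<in> R"
    using Imp.prems by (auto simp: world_def)
  then show ?case using Imp.IH[OF Imp.prems] by auto
next
  case (Box A)
  let ?A = "sem (canon_N \<Sigma>) canon_v A"
  have "(L, R) \<in> canon_N \<Sigma> ?A" if "Box A \<in> L"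
    by (rule canon_NI[of _ _ "{}" "{A}" "{}"]) (use that Box.IH in \<open>auto simp: admissible_def\<close>)
  moreover have "(L, R) \<notin> canon_N \<Sigma> ?A" if A: "Box A \<in> R"
  proof
    assume "(L, R) \<in> canon_N \<Sigma> ?A"
    then obtain S\<^sub>0 \<Lambda> \<Pi> where adm: "admissible \<Sigma> L S\<^sub>0 \<Lambda> \<Pi>" and
      sub: "\<And>L R. world \<Sigma> (L, R) \<Longrightarrow> set_mset (modal_context S\<^sub>0 \<Lambda> \<Pi>) \<subseteq> L \<Longrightarrow> (L, R) \<in> ?A"
      by (rule canon_NE) blast
    have "\<not> derivable (\<Sigma>, modal_context S\<^sub>0 \<Lambda> \<Pi>, {#A#})" using Box.prems A adm unfolding world_def by blast
    then obtain L' R' where w: "world \<Sigma> (L', R')" "set_mset (modal_context S\<^sub>0 \<Lambda> \<Pi>) \<subseteq> L'" "set_mset {#A#} \<subseteq> R'"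
      by (rule world_extends)
    then show False using sub[OF w(1,2)] Box.IH[OF w(1)] by auto
  qed
  ultimately show ?case by simp
next
  case (BoxP A)
  let ?A = "sem (canon_N \<Sigma>) canon_v A" and ?Z = "sem (canon_N \<Sigma>) canon_v (BoxP A)"
  have "mono (\<lambda>Z. canon_N \<Sigma> (?A \<inter> Z))" by (intro monoI canon_N_mono) auto
  from gfp_unfold[OF this] have Z: "?Z = canon_N \<Sigma> (?A \<inter> ?Z)" by simp
  \<comment> \<open>Coinduction on the worlds with \<open>BoxP A\<close> on the left. The choice of
    \<open>{A}\<close> for \<Pi> puts \<open>A\<close> and \<open>BoxP A\<close> into the context,
    so the worlds extending it satisfy \<open>A\<close> and stay in the set.\<close>
  have "{(L, R). BoxP A \<in> L \<and> world \<Sigma> (L, R)} \<subseteq> ?Z"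
    unfolding sem.simps
  proof (rule gfp_upperbound, clarify)
    fix L R assume "BoxP A \<in> L"
    then show "(L, R) \<in> canon_N \<Sigma> (?A \<inter> {(L, R). BoxP A \<in> L \<and> world \<Sigma> (L, R)})"
      by (intro canon_NI[of _ _ "{}" "{}" "{A}"]) (use BoxP.IH in \<open>auto simp: admissible_def\<close>)
  qed
  then have left: "(L, R) \<in> ?Z" if "BoxP A \<in> L" using that BoxP.prems by blast
  moreover have "(L, R) \<notin> ?Z" if A: "BoxP A \<in> R"
  proof
    assume "(L, R) \<in> ?Z"
    then have "(L, R) \<in> canon_N \<Sigma> (?A \<inter> ?Z)" by (rule equalityD1[OF Z, THEN subsetD])
    then obtain S\<^sub>0 \<Lambda> \<Pi> where adm: "admissible \<Sigma> L S\<^sub>0 \<Lambda> \<Pi>" and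
      sub: "\<And>L R. world \<Sigma> (L, R) \<Longrightarrow> set_mset (modal_context S\<^sub>0 \<Lambda> \<Pi>) \<subseteq> L \<Longrightarrow> (L, R) \<in> ?A \<inter> ?Z"
      by (rule canon_NE) blast
    have "derivable (\<Sigma>, modal_context S\<^sub>0 \<Lambda> \<Pi>, {#A#})"
    proof (rule ccontr)
      assume "\<not> ?thesis"
      then obtain L' R' where w: "world \<Sigma> (L', R')" "set_mset (modal_context S\<^sub>0 \<Lambda> \<Pi>) \<subseteq> L'" "set_mset {#A#} \<subseteq> R'"
        by (rule world_extends)
      then show False using sub[OF w(1,2)] BoxP.IH[OF w(1)] by auto
    qed
    \<comment> \<open>\<open>BoxP A\<close> is no smaller formula, so the induction hypothesis does
      not reach the right premise; its infinite proof is extracted from the fixed point equation of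
      \<open>?Z\<close>.\<close>
    moreover have "derivable (\<Sigma>, modal_context S\<^sub>0 \<Lambda> \<Pi>, {#BoxP A#})"
      by (rule derivable_BoxP[OF Z]) (use sub BoxP.IH in auto)
    ultimately show False using BoxP.prems A adm unfolding world_def by blast
  qed
  ultimately show ?case by blast
qed

text \<open>A context drawn from \<Sigma> alone is admissible whatever \<open>L\<close> is. With
  \<open>{A}\<close> for \<open>S\<^sub>0\<close>, \<open>Box A\<close> therefore holds at every
  pair, because worlds containing \<open>A\<close> satisfy it by \<open>truth\<close>.\<close>

lemma canonical_frame: "frame (canon_N \<Sigma>) canon_v \<Sigma>"
proof
  fix U V :: "(fm set \<times> fm set) set" and A
  show "U \<subseteq> V \<Longrightarrow> canon_N \<Sigma> U \<subseteq> canon_N \<Sigma> V" by (rule canon_N_mono)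
  show "canon_N \<Sigma> U \<inter> canon_N \<Sigma> V \<subseteq> canon_N \<Sigma> (U \<inter> V)" by (rule canon_N_Int)
  have "x \<in> canon_N \<Sigma> UNIV" for x
    by (cases x) (auto intro!: canon_NI[of _ _ "{}" "{}" "{}"] simp: admissible_def)
  then show "canon_N \<Sigma> UNIV = UNIV" by blast
  assume "A \<in> \<Sigma>"
  then have "x \<in> canon_N \<Sigma> (sem (canon_N \<Sigma>) canon_v A)" for x
    by (cases x) (auto intro!: canon_NI[of _ _ "{A}" "{}" "{}"] simp: admissible_def truth)
  then show "canon_N \<Sigma> (sem (canon_N \<Sigma>) canon_v A) = UNIV" by blast
qed

theorem theorem21:
  fixes \<Sigma> :: "fm set" and \<Gamma> \<Delta> :: "fm multiset"
  assumes "provable_with_cut (\<Sigma>, \<Gamma>, \<Delta>)"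
  shows "\<exists>t. inf_proof t \<and> slim t \<and> cut_free t \<and> concl t = (\<Sigma>, \<Gamma>, \<Delta>)"
proof (rule ccontr)
  assume "\<not> ?thesis"
  then have "\<not> derivable (\<Sigma>, \<Gamma>, \<Delta>)" by (auto simp: derivable_def good_proof_def)
  then obtain L R where w: "world \<Sigma> (L, R)" "set_mset \<Gamma> \<subseteq> L" "set_mset \<Delta> \<subseteq> R" by (rule world_extends)
  obtain t where t: "inf_proof t" "concl t = (\<Sigma>, \<Gamma>, \<Delta>)"
    using assms by (auto simp: provable_with_cut_def)
  interpret frame "canon_N \<Sigma>" canon_v \<Sigma> by (rule canonical_frame)
  \<comment> \<open>The world comes from the lack of slim cut-free proofs, but it refutes every tree
    with this root, those with cuts included.\<close>
  have "refutes (L, R) t"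
    using truth[OF w(1)] w(2,3) t(2) by (auto simp: refutes_def holds_def)
  then show False using soundness t(1) by (auto simp: refuted_def)
qed

end
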